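(* Let $A\in\mathbb{R}^{m\times n}$, $\nu>0$, and let $h:\mathbb{R}^m\to\mathbb{R}$ be proper closed convex. Let $P_A=A(A^\top A)^\dagger A^\top$ and $$p_\nu(w)=h(w)+\frac1{2\nu}\|(I-P_A)w\|^2,$$ and suppose that $w^*$ is a minimizer of $p_\nu$ that is a sharp minimum, i.e. there exist $\delta,\alpha>0$ such that $$p_\nu(w)-p_\nu(w^* )\ge\alpha\|w-w^*\|\qquad\text{for all }w\text{ with }\|w-w^*\|\le\delta.$$ Let $w^0\in\mathbb{R}^m$ and $w^{k+1}=\mathrm{prox}_{\nu h}(P_Aw^k)$ for $k\ge0$. If there exists an iteration $K$ with $\|w^K-w^*\|\le\delta$, then for all $k\ge K$, $$\|w^{k+1}-w^*\|\le\min\Big\{\|w^k-w^*\|,\ \frac{1}{\alpha\nu}\|w^k-w^*\|^2\Big\}.$$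
   Context: $\|\cdot\|$ is the Euclidean norm and $\dagger$ the pseudo-inverse, so $P_A$ is the orthogonal projector onto the range of $A$. $\mathrm{prox}_{\nu h}(y)=\operatorname{argmin}_w\{h(w)+\frac1{2\nu}\|w-y\|^2\}$. Standing assumption: $h$ is separable, $h(w)=\sum_{i=1}^m h_i(w_i)$. The iteration is the proximal gradient method $w^{k+1}=\mathrm{prox}_{\nu h}(w^k-\nu\nabla g_\nu(w^k))$ for minimizing $h+g_\nu$, where $g_\nu(w)=\min_x\{g(x)+\frac1{2\nu}\|Ax-w\|^2\}$ with $g=0$, so that $g_\nu(w)=\frac1{2\nu}\|(I-P_A)w\|^2$ and $w-\nu\nabla g_\nu(w)=P_Aw$. *)

theory Defs
  imports "HOL-Analysis.Analysis"
begin

text \<open>The Moore--Penrose pseudo-inverse, characterized by the four Penrose equations.\<close>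

definition pseudo_inverse :: "real ^ 'n ^ 'm \<Rightarrow> real ^ 'm ^ 'n" where
  "pseudo_inverse A = (THE X. A ** X ** A = A \<and> X ** A ** X = X \<and>
     transpose (A ** X) = A ** X \<and> transpose (X ** A) = X ** A)"

definition range_proj :: "real ^ 'n ^ 'm \<Rightarrow> real ^ 'm ^ 'm" where
  "range_proj A = A ** pseudo_inverse (transpose A ** A) ** transpose A"

text \<open>Convex functions take values in the extended reals, as is implicit in the adjective
  ``proper''; a finite function \<open>f\<close> is covered as \<open>\<lambda>w. ereal (f w)\<close>.\<close>

definition epi :: "('a \<Rightarrow> ereal) \<Rightarrow> ('a \<times> real) set" where
  "epi h = {(w, t). h w \<le> ereal t}"

definition proper_fun :: "('a \<Rightarrow> ereal) \<Rightarrow> bool" where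
  "proper_fun h \<longleftrightarrow> (\<forall>w. h w \<noteq> -\<infinity>) \<and> (\<exists>w. h w \<noteq> \<infinity>)"

definition closed_fun :: "('a::topological_space \<Rightarrow> ereal) \<Rightarrow> bool" where
  "closed_fun h \<longleftrightarrow> closed (epi h)"

definition convex_fun :: "('a::real_vector \<Rightarrow> ereal) \<Rightarrow> bool" where
  "convex_fun h \<longleftrightarrow> convex (epi h)"

text \<open>The value \<open>-\<infinity>\<close> is excluded for the summands because \<open>\<infinity> + -\<infinity> = \<infinity>\<close> in \<open>ereal\<close>.\<close>

definition separable_fun :: "(real ^ 'm \<Rightarrow> ereal) \<Rightarrow> bool" where
  "separable_fun h \<longleftrightarrow> (\<exists>hc :: 'm \<Rightarrow> real \<Rightarrow> ereal.
     (\<forall>i t. hc i t \<noteq> -\<infinity>) \<and> (\<forall>w. h w = (\<Sum>i\<in>UNIV. hc i (w $ i))))"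

text \<open>For proper closed convex \<open>h\<close> and \<open>\<nu> > 0\<close> the minimizer exists and is unique, so the
  choice made by \<open>arg_min\<close> is immaterial.\<close>

definition prox :: "real \<Rightarrow> ('a::real_normed_vector \<Rightarrow> ereal) \<Rightarrow> 'a \<Rightarrow> 'a" where
  "prox \<nu> h y = arg_min (\<lambda>w. h w + ereal (1 / (2 * \<nu>) * (norm (w - y))\<^sup>2)) (\<lambda>_. True)"

definition relaxed_obj ::
    "real \<Rightarrow> real ^ 'n ^ 'm \<Rightarrow> (real ^ 'm \<Rightarrow> ereal) \<Rightarrow> real ^ 'm \<Rightarrow> ereal" where
  "relaxed_obj \<nu> A h w =
     h w + ereal (1 / (2 * \<nu>) * (norm ((mat 1 - range_proj A) *v w))\<^sup>2)"

end

theory Submission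
  imports Defs
begin

text \<open>
  Write \<open>P\<close> for the projector, \<open>s\<close> for the minimizer, \<open>x\<close> for the current iterate and
  \<open>y = prox \<nu> h (P x)\<close> for the next one. Both bounds come from comparing \<open>y\<close> with \<open>s\<close>.

  Since \<open>s\<close> minimizes a convex function plus a smooth quadratic, \<open>-(s - P s) / \<nu>\<close> is a subgradient
  of \<open>h\<close> at \<open>s\<close>, that is, \<open>s\<close> is a fixed point of the iteration; likewise \<open>-(y - P x) / \<nu>\<close> is a
  subgradient at \<open>y\<close> (\<open>penalized_minimizer_subgradient\<close>). Adding the two subgradient inequalities
  gives \<open>\<parallel>y - s\<parallel>\<^sup>2 \<le> P (x - s) \<bullet> (y - s)\<close>, hence \<open>\<parallel>y - s\<parallel> \<le> \<parallel>x - s\<parallel>\<close>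
  (\<open>prox_step_nonexpansive\<close>). This is the first bound, and it keeps all iterates after \<open>K\<close> in the
  ball where the minimum is sharp.

  For the second bound, \<open>h + \<parallel>\<cdot> - P x\<parallel>\<^sup>2 / (2 \<nu>)\<close> majorizes the objective, because \<open>P v\<close> is the point
  of the range nearest to \<open>v\<close>. By Pythagoras the majorization error at \<open>s\<close> is
  \<open>\<parallel>P (x - s)\<parallel>\<^sup>2 / (2 \<nu>)\<close>, and \<open>y\<close> minimizes the majorant, so the objective at \<open>y\<close> exceeds its
  minimum by at most \<open>\<parallel>x - s\<parallel>\<^sup>2 / (2 \<nu>)\<close> (\<open>prox_step_objective_gap\<close>). Sharpness bounds the same
  excess below by \<open>\<alpha> \<parallel>y - s\<parallel>\<close>.

  Two facts make the definitions usable: \<open>P\<close> is symmetric and idempotent, which rests on the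
  existence and uniqueness of the pseudo-inverse of \<open>A\<^sup>T A\<close>; and the minimum defining the proximal
  map is attained, for which the subgradient at \<open>s\<close> provides the affine minorant of \<open>h\<close>.
\<close>

section \<open>The projector\<close>

text \<open>For symmetric \<open>B\<close> the kernel is the orthogonal complement of the range \<open>V\<close>, so \<open>B\<close> restricts to
  a bijection of \<open>V\<close>. With \<open>g\<close> inverting this restriction, the pseudo-inverse is \<open>g \<circ> g \<circ> B\<close>: both
  its products with \<open>B\<close> are the orthogonal projector \<open>E = g \<circ> B\<close> onto \<open>V\<close>.\<close>

lemma symmetric_pseudo_inverse_exists:
  fixes B :: "real ^ 'n ^ 'n"
  assumes sym: "transpose B = B"
  shows "\<exists>X. B ** X ** B = B \<and> X ** B ** X = X \<and>
     transpose (B ** X) = B ** X \<and> transpose (X ** B) = X ** B"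
proof -
  let ?V = "range ((*v) B)"
  have V: "subspace ?V"
    by (simp add: subspace_UNIV linear_subspace_image)
  have self_adj: "(B *v x) \<bullet> y = x \<bullet> (B *v y)" for x y
    by (metis dot_lmul_matrix inner_commute sym transpose_matrix_vector)
  have inj: "inj_on ((*v) B) ?V"
  proof (rule inj_onI)
    fix x y assume "x \<in> ?V" "y \<in> ?V" and eq: "B *v x = B *v y"
    then obtain u where u: "x - y = B *v u"
      using V subspace_diff by blast
    have "B *v (x - y) = 0"
      using eq by (simp add: matrix_vector_mult_diff_distrib)
    then have "(x - y) \<bullet> (x - y) = 0"
      by (metis u self_adj inner_zero_right)
    then show "x = y" by simp
  qed
  obtain g where g_V: "range g \<subseteq> ?V" and lin_g: "linear g"
    and gB: "\<And>v. v \<in> ?V \<Longrightarrow> g (B *v v) = v"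
    using linear_exists_left_inverse_on[OF _ V inj] by auto
  have Bg: "B *v g (B *v v) = B *v v" for v
  proof -
    obtain r k where r: "r \<in> ?V" and k: "\<And>x. x \<in> ?V \<Longrightarrow> k \<bullet> x = 0" and v: "v = r + k"
      using orthogonal_subspace_decomp_exists[of ?V v] V
      by (metis orthogonal_def span_eq_iff)
    have "(B *v k) \<bullet> (B *v k) = 0"
      by (metis self_adj k rangeI)
    then have "B *v v = B *v r"
      by (simp add: v matrix_vector_right_distrib)
    then show ?thesis using gB[OF r] by simp
  qed
  define E where "E = (\<lambda>v. g (B *v v))"
  have E_sym: "E u \<bullet> v = u \<bullet> E v" for u v
  proof -
    \<comment> \<open>\<open>E u\<close> lies in the range of \<open>B\<close>, and \<open>v - E v\<close> in its kernel.\<close>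
    have half: "E u \<bullet> v = E u \<bullet> E v" for u v
    proof -
      obtain c where c: "E u = B *v c" using g_V E_def by blast
      have "B *v (v - E v) = 0"
        by (simp add: E_def matrix_vector_mult_diff_distrib Bg)
      then have "E u \<bullet> (v - E v) = 0" by (simp add: c self_adj)
      then show ?thesis by (simp add: inner_diff_right)
    qed
    show ?thesis using half[of u v] half[of v u] by (simp add: inner_commute)
  qed
  define X where "X = matrix (\<lambda>v. g (g (B *v v)))"
  have Xv: "X *v v = g (g (B *v v))" for v
    unfolding X_def
    by (rule matrix_works) (use linear_compose[OF linear_compose[OF matrix_vector_mul_linear lin_g] lin_g]
        in \<open>simp add: o_def linear_matrix_vector_mul_eq\<close>)
  have BX: "B *v (X *v v) = E v" for v
  proof -
    obtain c where "g (B *v v) = B *v c" using g_V by blast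
    then show ?thesis using Bg by (simp add: Xv E_def)
  qed
  have XB: "X *v (B *v v) = E v" for v
    by (simp add: Xv E_def gB)
  have sym_if: "transpose M = M" if "\<And>v. M *v v = E v" for M
    by (metis (no_types) that E_sym adjoint_unique adjoint_matrix matrix_eq)
  have "B ** X ** B = B"
    by (simp add: matrix_eq flip: matrix_vector_mul_assoc) (simp add: XB E_def Bg)
  moreover have "X ** B ** X = X"
    by (simp add: matrix_eq flip: matrix_vector_mul_assoc)
      (metis BX E_def XB Xv g_V gB rangeI subsetD)
  moreover have "transpose (B ** X) = B ** X" "transpose (X ** B) = X ** B"
    by (rule sym_if; simp add: BX XB flip: matrix_vector_mul_assoc)+
  ultimately show ?thesis by blast
qed

lemma penrose_unique:
  fixes B :: "real ^ 'n ^ 'm" and X Y :: "real ^ 'm ^ 'n"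
  assumes X: "B ** X ** B = B" "X ** B ** X = X" "transpose (B ** X) = B ** X" "transpose (X ** B) = X ** B"
    and Y: "B ** Y ** B = B" "Y ** B ** Y = Y" "transpose (B ** Y) = B ** Y" "transpose (Y ** B) = Y ** B"
  shows "X = Y"
proof -
  have "B ** X = transpose (B ** Y ** (B ** X))"
    by (metis X(3) Y(1) matrix_mul_assoc)
  then have BX: "B ** X = B ** Y"
    by (metis X(1,3) Y(3) matrix_mul_assoc matrix_transpose_mul)
  have "X ** B = transpose (X ** B ** (Y ** B))"
    by (metis X(4) Y(1) matrix_mul_assoc)
  then have XB: "X ** B = Y ** B"
    by (metis X(1,4) Y(4) matrix_mul_assoc matrix_transpose_mul)
  have "X = X ** (B ** X)" by (simp add: X(2) matrix_mul_assoc)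
  also have "\<dots> = Y ** B ** Y" by (simp add: BX XB matrix_mul_assoc)
  finally show ?thesis by (simp add: Y(2))
qed

text \<open>Transposing the Penrose equations of a symmetric \<open>B\<close> shows that the transpose of a solution
  solves them too, so uniqueness makes the pseudo-inverse symmetric.\<close>

lemma symmetric_pseudo_inverse:
  fixes B :: "real ^ 'n ^ 'n"
  assumes sym: "transpose B = B"
  defines "X \<equiv> pseudo_inverse B"
  shows "X ** B ** X = X" "transpose X = X"
proof -
  let ?Q = "\<lambda>X. B ** X ** B = B \<and> X ** B ** X = X \<and>
     transpose (B ** X) = B ** X \<and> transpose (X ** B) = X ** B"
  have "\<exists>!X. ?Q X"
    by (rule ex_ex1I[OF symmetric_pseudo_inverse_exists[OF sym]]) (use penrose_unique in blast)
  then have Q: "?Q X"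
    unfolding X_def pseudo_inverse_def by (rule theI')
  then show "X ** B ** X = X" by blast
  have "?Q (transpose X)"
    by (metis Q sym matrix_mul_assoc matrix_transpose_mul transpose_transpose)
  then show "transpose X = X"
    using Q penrose_unique by blast
qed

lemma range_proj_symmetric: "(range_proj A *v x) \<bullet> y = x \<bullet> (range_proj A *v y)"
proof -
  have "transpose (range_proj A) = range_proj A"
    by (simp add: range_proj_def matrix_transpose_mul matrix_mul_assoc symmetric_pseudo_inverse(2))
  then show ?thesis
    by (metis dot_lmul_matrix inner_commute transpose_matrix_vector)
qed

lemma range_proj_idem: "range_proj A *v (range_proj A *v x) = range_proj A *v x"
proof -
  define B where "B = transpose A ** A"
  have "pseudo_inverse B ** B ** pseudo_inverse B = pseudo_inverse B"
    by (rule symmetric_pseudo_inverse) (simp add: B_def matrix_transpose_mul)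
  then have "range_proj A ** range_proj A = range_proj A"
    unfolding range_proj_def by (metis B_def matrix_mul_assoc)
  then show ?thesis by (simp add: matrix_vector_mul_assoc)
qed

lemma range_proj_residual_orthogonal:
  "(v - range_proj A *v v) \<bullet> (range_proj A *v u) = 0"
  by (simp add: matrix_vector_mult_diff_distrib range_proj_idem flip: range_proj_symmetric)

lemma range_proj_norm_le: "norm (range_proj A *v x) \<le> norm x"
proof -
  have "(norm (range_proj A *v x))\<^sup>2 = x \<bullet> (range_proj A *v x)"
    by (simp add: power2_norm_eq_inner range_proj_symmetric range_proj_idem)
  also have "\<dots> \<le> norm x * norm (range_proj A *v x)"
    by (rule norm_cauchy_schwarz)
  finally show ?thesis
    by (cases "range_proj A *v x = 0") (simp_all add: power2_eq_square)
qed

section \<open>Convex functions with a quadratic penalty\<close>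

lemma penalized_minimizer_finite:
  assumes "proper_fun h" and min: "is_arg_min (\<lambda>w. h w + ereal (q w)) (\<lambda>_. True) s"
  obtains a where "h s = ereal a"
proof -
  obtain w where "h w \<noteq> \<infinity>" using assms(1) by (auto simp: proper_fun_def)
  moreover have "h s + ereal (q s) \<le> h w + ereal (q w)"
    using min by (simp add: is_arg_min_linorder)
  ultimately have "h s \<noteq> \<infinity>" by (cases "h w") auto
  moreover have "h s \<noteq> -\<infinity>" using assms(1) by (auto simp: proper_fun_def)
  ultimately show ?thesis by (cases "h s") (auto intro: that)
qed

text \<open>The first-order optimality condition, obtained without differentiating \<open>h\<close>: moving from \<open>s\<close> a
  fraction \<open>r\<close> of the way to \<open>u\<close> changes \<open>h\<close> by at most \<open>r (t - a)\<close> and the penalty by a linear term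
  in \<open>r\<close> plus \<open>O(r\<^sup>2)\<close>; dividing by \<open>r\<close> and letting \<open>r \<rightarrow> 0\<close> leaves the linear terms. Quantifying over
  the epigraph instead of values of \<open>h\<close> keeps the inequality in the reals. The map \<open>M\<close> is \<open>I - P\<close>
  for the relaxed objective and the identity for the proximal map.\<close>

lemma penalized_minimizer_subgradient:
  fixes M :: "'a::real_vector \<Rightarrow> 'b::real_inner"
  assumes conv: "convex_fun h" and lin: "linear M"
    and min: "is_arg_min (\<lambda>w. h w + ereal (c * (norm (M w - z))\<^sup>2)) (\<lambda>_. True) s"
    and s: "h s = ereal a" and ut: "(u, t) \<in> epi h"
  shows "a - 2 * c * ((M s - z) \<bullet> M (u - s)) \<le> t"
proof -
  let ?l = "2 * c * ((M s - z) \<bullet> M (u - s))" and ?k = "c * (norm (M (u - s)))\<^sup>2"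
  have step: "0 \<le> t - a + ?l + r * ?k" if r: "0 < r" "r < 1" for r
  proof -
    have "(s, a) \<in> epi h" by (simp add: epi_def s)
    then have "(1 - r) *\<^sub>R (s, a) + r *\<^sub>R (u, t) \<in> epi h"
      using conv ut r unfolding convex_fun_def by (intro convexD) auto
    moreover have "(1 - r) *\<^sub>R s + r *\<^sub>R u = s + r *\<^sub>R (u - s)"
      by (simp add: algebra_simps)
    ultimately have "h (s + r *\<^sub>R (u - s)) \<le> ereal ((1 - r) * a + r * t)"
      by (simp add: epi_def)
    moreover have "h s + ereal (c * (norm (M s - z))\<^sup>2)
        \<le> h (s + r *\<^sub>R (u - s)) + ereal (c * (norm (M (s + r *\<^sub>R (u - s)) - z))\<^sup>2)"
      using min by (simp add: is_arg_min_linorder)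
    ultimately have "h s + ereal (c * (norm (M s - z))\<^sup>2)
        \<le> ereal ((1 - r) * a + r * t) + ereal (c * (norm (M (s + r *\<^sub>R (u - s)) - z))\<^sup>2)"
      by (meson add_right_mono order_trans)
    then have "a + c * (norm (M s - z))\<^sup>2
        \<le> (1 - r) * a + r * t + c * (norm (M (s + r *\<^sub>R (u - s)) - z))\<^sup>2"
      by (simp add: s)
    moreover have "M (s + r *\<^sub>R (u - s)) - z = (M s - z) + r *\<^sub>R M (u - s)"
      by (simp add: linear_add[OF lin] linear_scale[OF lin])
    then have "c * (norm (M (s + r *\<^sub>R (u - s)) - z))\<^sup>2
        = c * (norm (M s - z))\<^sup>2 + r * ?l + r * (r * ?k)"
      unfolding power2_norm_eq_inner
      by (simp add: inner_add_left inner_add_right inner_commute algebra_simps)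
    ultimately have "0 \<le> r * (t - a + ?l + r * ?k)"
      by (simp add: algebra_simps)
    then show ?thesis using r by (simp add: zero_le_mult_iff)
  qed
  have "((\<lambda>r. t - a + ?l + r * ?k) \<longlongrightarrow> t - a + ?l + 0 * ?k) (at_right 0)"
    by (intro tendsto_intros)
  moreover have "\<forall>\<^sub>F r in at_right 0. 0 \<le> t - a + ?l + r * ?k"
    using step by (auto simp: eventually_at_right[of 0 1] intro!: exI[of _ 1])
  ultimately have "0 \<le> t - a + ?l + 0 * ?k"
    by (rule tendsto_lowerbound) simp
  then show ?thesis by simp
qed

text \<open>An affine minorant makes the penalized function coercive. Its minimization becomes that of the
  continuous function \<open>f\<close> over the closed epigraph of \<open>h\<close>, where the sublevel sets of \<open>f\<close> are compact.\<close>

lemma prox_is_arg_min: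
  fixes h :: "'a::euclidean_space \<Rightarrow> ereal"
  assumes \<nu>: "\<nu> > 0" and cl: "closed_fun h" and proper: "proper_fun h"
    and minorant: "\<And>u t. (u, t) \<in> epi h \<Longrightarrow> b + g \<bullet> u \<le> t"
  shows "is_arg_min (\<lambda>w. h w + ereal (1 / (2 * \<nu>) * (norm (w - y))\<^sup>2)) (\<lambda>_. True) (prox \<nu> h y)"
proof -
  define c where "c = 1 / (2 * \<nu>)"
  have c: "c > 0" using \<nu> by (simp add: c_def)
  define f where "f = (\<lambda>(w, t). t + c * (norm (w - y))\<^sup>2)"
  have f: "continuous_on S f" for S
    unfolding f_def case_prod_beta by (intro continuous_intros)
  obtain s a where s: "(s, a) \<in> epi h"
  proof -
    obtain s where "h s \<noteq> \<infinity>" "h s \<noteq> -\<infinity>" using proper by (auto simp: proper_fun_def)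
    then show ?thesis by (intro that[of s "real_of_ereal (h s)"]) (auto simp: epi_def ereal_real)
  qed
  define C where "C = f (s, a)"
  define S where "S = epi h \<inter> {p. f p \<le> C}"
  \<comment> \<open>Large enough that, outside the ball of radius \<open>R\<close> about \<open>y\<close>, the quadratic beats the affine
    minorant and \<open>f\<close> exceeds the level \<open>C\<close>.\<close>
  define R where "R = (\<bar>C - b - g \<bullet> y\<bar> + norm g) / c + 1"
  have R: "c * R = \<bar>C - b - g \<bullet> y\<bar> + norm g + c" and "R \<ge> 1"
    using c by (simp_all add: R_def field_simps)
  have "S \<subseteq> cball y R \<times> {b + g \<bullet> y - norm g * R .. C}"
  proof (rule subrelI)
    fix w t assume "(w, t) \<in> S"
    then have lo: "b + g \<bullet> w \<le> t" and up: "t + c * (norm (w - y))\<^sup>2 \<le> C"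
      using minorant by (auto simp: S_def f_def)
    have cs: "g \<bullet> y - norm g * norm (w - y) \<le> g \<bullet> w"
      using norm_cauchy_schwarz[of g "y - w"]
      by (simp add: inner_diff_right norm_minus_commute)
    have q: "c * (norm (w - y))\<^sup>2 \<le> \<bar>C - b - g \<bullet> y\<bar> + norm g * norm (w - y)"
      using lo up cs by linarith
    have wR: "norm (w - y) \<le> R"
    proof (rule ccontr)
      assume gt: "\<not> norm (w - y) \<le> R"
      then have n1: "norm (w - y) > 1" using \<open>R \<ge> 1\<close> by simp
      have "(c * R) * norm (w - y) \<le> c * (norm (w - y))\<^sup>2"
        using gt c by (simp add: power2_eq_square mult_right_mono)
      moreover have "\<bar>C - b - g \<bullet> y\<bar> * 1 \<le> \<bar>C - b - g \<bullet> y\<bar> * norm (w - y)"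
        using n1 by (intro mult_left_mono) auto
      moreover have "c * norm (w - y) > 0" using c by (rule mult_pos_pos) (use n1 in linarith)
      ultimately show False
        using q unfolding R by (simp add: algebra_simps)
    qed
    moreover have "norm g * norm (w - y) \<le> norm g * R"
      using wR by (simp add: mult_left_mono)
    moreover have "0 \<le> c * (norm (w - y))\<^sup>2" using c by simp
    ultimately show "(w, t) \<in> cball y R \<times> {b + g \<bullet> y - norm g * R .. C}"
      using lo up cs by (auto simp: dist_norm norm_minus_commute)
  qed
  then have "bounded S"
    by (rule bounded_subset[rotated]) (intro bounded_Times bounded_cball bounded_closed_interval)
  moreover have "closed S"
    unfolding S_def using cl f
    by (intro closed_Int closed_Collect_le continuous_on_const) (auto simp: closed_fun_def)
  moreover have "(s, a) \<in> S" using s by (simp add: S_def C_def)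
  ultimately obtain w0 t0 where m: "(w0, t0) \<in> S" and least: "\<And>p. p \<in> S \<Longrightarrow> f (w0, t0) \<le> f p"
    using continuous_attains_inf[of S f] f compact_eq_bounded_closed by (metis empty_iff surj_pair)
  have least': "f (w0, t0) \<le> f p" if "p \<in> epi h" for p
    using least[of p] m that by (force simp: S_def)
  have "h w0 + ereal (c * (norm (w0 - y))\<^sup>2) \<le> h w + ereal (c * (norm (w - y))\<^sup>2)" for w
  proof (cases "h w")
    case (real t)
    have "h w0 + ereal (c * (norm (w0 - y))\<^sup>2) \<le> ereal t0 + ereal (c * (norm (w0 - y))\<^sup>2)"
      using m by (intro add_right_mono) (simp add: S_def epi_def)
    also have "\<dots> \<le> ereal t + ereal (c * (norm (w - y))\<^sup>2)"
      using least'[of "(w, t)"] real by (simp add: epi_def f_def)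
    finally show ?thesis using real by simp
  qed (use proper in \<open>auto simp: proper_fun_def\<close>)
  then have "is_arg_min (\<lambda>w. h w + ereal (c * (norm (w - y))\<^sup>2)) (\<lambda>_. True) w0"
    by (simp add: is_arg_min_linorder)
  then show ?thesis
    unfolding prox_def arg_min_def c_def by (rule someI)
qed

section \<open>Contraction and quadratic decrease\<close>

context
  fixes A :: "real ^ 'n ^ 'm" and h :: "real ^ 'm \<Rightarrow> ereal" and \<nu> :: real and s x :: "real ^ 'm"
  assumes \<nu>: "\<nu> > 0" and h: "proper_fun h" "closed_fun h" "convex_fun h"
    and s: "is_arg_min (relaxed_obj \<nu> A h) (\<lambda>_. True) s"
begin

private abbreviation (input) "P \<equiv> (*v) (range_proj A)"
private abbreviation (input) "y \<equiv> prox \<nu> h (P x)"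

lemma relaxed_minimizer_finite:
  obtains a where "h s = ereal a"
  using penalized_minimizer_finite[OF h(1) s[unfolded relaxed_obj_def[abs_def]]] by blast

text \<open>The penalty has gradient \<open>(I - P)\<^sup>T (I - P) s / \<nu>\<close>, which is \<open>(s - P s) / \<nu>\<close> for a projector.\<close>

lemma relaxed_minimizer_subgradient:
  assumes "h s = ereal a" "(u, t) \<in> epi h"
  shows "a - ((s - P s) \<bullet> (u - s)) / \<nu> \<le> t"
proof -
  have "(s - P s) \<bullet> P (u - s) = 0"
    by (rule range_proj_residual_orthogonal)
  moreover have "a - 2 * (1 / (2 * \<nu>)) * (((mat 1 - range_proj A) *v s - 0) \<bullet> ((mat 1 - range_proj A) *v (u - s))) \<le> t"
    by (rule penalized_minimizer_subgradient[OF h(3) _ _ assms])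
      (use s in \<open>simp_all add: relaxed_obj_def[abs_def] matrix_vector_mul_linear\<close>)
  ultimately show ?thesis
    by (simp add: matrix_vector_mult_diff_rdistrib inner_diff_right matrix_vector_mult_diff_distrib)
qed

lemma prox_relaxed_is_arg_min:
  "is_arg_min (\<lambda>w. h w + ereal (1 / (2 * \<nu>) * (norm (w - z))\<^sup>2)) (\<lambda>_. True) (prox \<nu> h z)"
proof -
  obtain a where a: "h s = ereal a" by (rule relaxed_minimizer_finite)
  let ?g = "- (1 / \<nu>) *\<^sub>R (s - P s)"
  have "(a - ?g \<bullet> s) + ?g \<bullet> u \<le> t" if "(u, t) \<in> epi h" for u t
    using relaxed_minimizer_subgradient[OF a that]
    by (simp add: inner_diff_right diff_divide_distrib)
  then show ?thesis by (rule prox_is_arg_min[OF \<nu> h(2,1)])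
qed

lemma prox_step_finite:
  obtains b where "h y = ereal b"
  using penalized_minimizer_finite[OF h(1) prox_relaxed_is_arg_min] by blast

lemma prox_step_subgradient:
  assumes "h y = ereal b" "(u, t) \<in> epi h"
  shows "b - ((y - P x) \<bullet> (u - y)) / \<nu> \<le> t"
  using penalized_minimizer_subgradient[OF h(3) linear_id, of "1 / (2 * \<nu>)" "P x" y b u t]
    prox_relaxed_is_arg_min[of "P x"] assms by simp

text \<open>Adding the subgradient inequalities of \<open>h\<close> at \<open>s\<close> and at \<open>y\<close> cancels the values of \<open>h\<close>.\<close>

lemma prox_step_nonexpansive: "norm (y - s) \<le> norm (x - s)"
proof -
  obtain a where a: "h s = ereal a" by (rule relaxed_minimizer_finite)
  obtain b where b: "h y = ereal b" by (rule prox_step_finite)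
  have "a - ((s - P s) \<bullet> (y - s)) / \<nu> \<le> b" 
    by (rule relaxed_minimizer_subgradient[OF a]) (simp add: epi_def b)
  moreover have "b - ((y - P x) \<bullet> (s - y)) / \<nu> \<le> a" 
    by (rule prox_step_subgradient[OF b]) (simp add: epi_def a)
  ultimately have "0 \<le> ((s - P s) \<bullet> (y - s) + (y - P x) \<bullet> (s - y)) / \<nu>"
    by (simp add: add_divide_distrib)
  then have "0 \<le> (s - P s) \<bullet> (y - s) + (y - P x) \<bullet> (s - y)"
    using \<nu> by (simp add: zero_le_divide_iff)
  also have "\<dots> = P (x - s) \<bullet> (y - s) - (norm (y - s))\<^sup>2"
    by (simp add: power2_norm_eq_inner matrix_vector_mult_diff_distrib inner_diff_left
        inner_diff_right inner_commute)
  finally have "(norm (y - s))\<^sup>2 \<le> norm (P (x - s)) * norm (y - s)"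
    using norm_cauchy_schwarz[of "P (x - s)" "y - s"] by linarith
  also have "\<dots> \<le> norm (x - s) * norm (y - s)"
    by (intro mult_right_mono range_proj_norm_le) simp
  finally show ?thesis
    by (cases "y = s") (simp_all add: power2_eq_square)
qed

text \<open>Majorization-minimization: by \<open>pyth\<close>, the distance to \<open>P x\<close> exceeds the distance to the range,
  and at \<open>s\<close> the squares differ by only \<open>\<parallel>P (s - x)\<parallel>\<^sup>2\<close>.\<close>

lemma prox_step_objective_gap:
  "relaxed_obj \<nu> A h y - relaxed_obj \<nu> A h s \<le> ereal (1 / (2 * \<nu>) * (norm (x - s))\<^sup>2)"
proof -
  obtain a where a: "h s = ereal a" by (rule relaxed_minimizer_finite)
  obtain b where b: "h y = ereal b" by (rule prox_step_finite)
  have pyth: "(norm (v - P x))\<^sup>2 = (norm (v - P v))\<^sup>2 + (norm (P (v - x)))\<^sup>2" for v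
  proof -
    have "(v - P v) \<bullet> P (v - x) = 0"
      by (rule range_proj_residual_orthogonal)
    moreover have "v - P x = (v - P v) + P (v - x)"
      by (simp add: matrix_vector_mult_diff_distrib)
    ultimately show ?thesis
      by (metis norm_add_Pythagorean orthogonal_def)
  qed
  have "h y + ereal (1 / (2 * \<nu>) * (norm (y - P x))\<^sup>2) \<le> h s + ereal (1 / (2 * \<nu>) * (norm (s - P x))\<^sup>2)"
    using prox_relaxed_is_arg_min[of "P x"] by (simp add: is_arg_min_linorder)
  then have "b + 1 / (2 * \<nu>) * (norm (y - P x))\<^sup>2 \<le> a + 1 / (2 * \<nu>) * (norm (s - P x))\<^sup>2"
    by (simp add: a b)
  moreover have "1 / (2 * \<nu>) * (norm (y - P y))\<^sup>2 \<le> 1 / (2 * \<nu>) * (norm (y - P x))\<^sup>2"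
    using \<nu> by (intro mult_left_mono) (simp_all add: pyth)
  moreover have "(norm (P (s - x)))\<^sup>2 \<le> (norm (x - s))\<^sup>2"
    using range_proj_norm_le[of A "s - x"] by (simp add: norm_minus_commute power_mono)
  then have "1 / (2 * \<nu>) * (norm (s - P x))\<^sup>2
      \<le> 1 / (2 * \<nu>) * ((norm (s - P s))\<^sup>2 + (norm (x - s))\<^sup>2)"
    using \<nu> by (intro mult_left_mono) (simp_all add: pyth)
  ultimately have "b + 1 / (2 * \<nu>) * (norm (y - P y))\<^sup>2
      - (a + 1 / (2 * \<nu>) * (norm (s - P s))\<^sup>2) \<le> 1 / (2 * \<nu>) * (norm (x - s))\<^sup>2"
    unfolding distrib_left by linarith
  then show ?thesis
    by (simp add: relaxed_obj_def a b matrix_vector_mult_diff_rdistrib)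
qed

end

theorem theorem9:
  fixes A :: "real ^ 'n ^ 'm"
    and h :: "real ^ 'm \<Rightarrow> ereal"
    and \<nu> \<delta> \<alpha> :: real
    and wstar :: "real ^ 'm"
    and w :: "nat \<Rightarrow> real ^ 'm"
    and K :: nat
  assumes "\<nu> > 0"
    and "proper_fun h" and "closed_fun h" and "convex_fun h"
    and "separable_fun h"
    and "is_arg_min (relaxed_obj \<nu> A h) (\<lambda>_. True) wstar"
    and "\<delta> > 0" and "\<alpha> > 0"
    and "\<forall>v. norm (v - wstar) \<le> \<delta> \<longrightarrow>
           relaxed_obj \<nu> A h v - relaxed_obj \<nu> A h wstar \<ge> ereal (\<alpha> * norm (v - wstar))"
    and "\<forall>k. w (Suc k) = prox \<nu> h (range_proj A *v w k)"
    and "norm (w K - wstar) \<le> \<delta>"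
  shows "\<forall>k\<ge>K. norm (w (Suc k) - wstar)
           \<le> min (norm (w k - wstar)) (1 / (\<alpha> * \<nu>) * (norm (w k - wstar))\<^sup>2)"
proof (intro allI impI)
  fix k assume "K \<le> k"
  have shrink: "norm (w (Suc j) - wstar) \<le> norm (w j - wstar)" for j
    using prox_step_nonexpansive[OF assms(1-4,6), of "w j"] assms(10) by simp
  have "norm (w (Suc k) - wstar) \<le> norm (w K - wstar)"
    using lift_Suc_antimono_le[of "\<lambda>j. norm (w j - wstar)" K "Suc k"] shrink \<open>K \<le> k\<close> by simp
  then have "norm (w (Suc k) - wstar) \<le> \<delta>"
    using assms(11) by simp
  then have "ereal (\<alpha> * norm (w (Suc k) - wstar))
      \<le> relaxed_obj \<nu> A h (w (Suc k)) - relaxed_obj \<nu> A h wstar"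
    using assms(9) by blast
  also have "\<dots> \<le> ereal (1 / (2 * \<nu>) * (norm (w k - wstar))\<^sup>2)"
    using prox_step_objective_gap[OF assms(1-4,6), of "w k"] assms(10) by simp
  finally have "\<alpha> * norm (w (Suc k) - wstar) \<le> 1 / (2 * \<nu>) * (norm (w k - wstar))\<^sup>2"
    by simp
  also have "\<dots> \<le> 1 / \<nu> * (norm (w k - wstar))\<^sup>2"
    using \<open>\<nu> > 0\<close> by (intro mult_right_mono) (simp_all add: field_simps)
  finally have "norm (w (Suc k) - wstar) \<le> 1 / (\<alpha> * \<nu>) * (norm (w k - wstar))\<^sup>2"
    using \<open>\<nu> > 0\<close> \<open>\<alpha> > 0\<close> by (simp add: field_simps)
  with shrink[of k] show "norm (w (Suc k) - wstar)
      \<le> min (norm (w k - wstar)) (1 / (\<alpha> * \<nu>) * (norm (w k - wstar))\<^sup>2)"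
    by simp
qed

end
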